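(* Let $n,m\ge1$ be integers, let $s_1,\ldots,s_m>0$ and set $\lambda=\sum_{j=1}^m s_j$. Then $$A^\infty_\lambda\subset{\rm Trace}\;\tilde hA^\infty_{\overrightarrow{s}}.$$ Conversely, if $f\in A^\infty_{\overrightarrow{s}}$ and if ${\rm Tr}\,f$ is harmonic, then ${\rm Tr}\,f\in A^\infty_\lambda$.
   Context: $\mathbb R^{n+1}_+=\{(x,t):x\in\mathbb R^n,\ t>0\}$; points are written $z=(x,t)$, $z_j=(x_j,t_j)$. $h((\mathbb R^{n+1}_+)^m)$ is the space of harmonic functions on $(\mathbb R^{n+1}_+)^m$ regarded as a domain in $\mathbb R^{m(n+1)}$; $\tilde h((\mathbb R^{n+1}_+)^m)$ is the space of functions $f(z_1,\ldots,z_m)$ harmonic in each variable $z_j\in\mathbb R^{n+1}_+$ separately. For $\overrightarrow{s}=(s_1,\ldots,s_m)$ with all $s_j>0$, $A^\infty_{\overrightarrow{s}}$ is the space of all $f\in h((\mathbb R^{n+1}_+)^m)$ with $$\|f\|_{A^\infty_{\overrightarrow{s}}}=\sup_{z_1,\ldots,z_m\in\mathbb R^{n+1}_+}|f(z_1,\ldots,z_m)|\,t_1^{s_1}\cdots t_m^{s_m}<\infty;$$ for $m=1$, $s_1=\lambda$ it is denoted $A^\infty_\lambda$ (functions harmonic on $\mathbb R^{n+1}_+$). $\tilde hA^\infty_{\overrightarrow{s}}=A^\infty_{\overrightarrow{s}}\cap\tilde h((\mathbb R^{n+1}_+)^m)$. For $f:(\mathbb R^{n+1}_+)^m\to\mathbb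 C$, ${\rm Tr}f(z)=f(z,\ldots,z)$ for $z\in\mathbb R^{n+1}_+$, and for a space $X$ of such functions ${\rm Trace}\,X=\{{\rm Tr}f:f\in X\}$. *)

theory Defs
  imports "HOL-Analysis.Analysis"
begin

definition has_partial_on ::
  "'a::euclidean_space set \<Rightarrow> 'a \<Rightarrow> ('a \<Rightarrow> 'b::real_normed_vector) \<Rightarrow> bool" where
  "has_partial_on U b f \<longleftrightarrow> (\<forall>x\<in>U. (\<lambda>h::real. f (x + h *\<^sub>R b)) differentiable (at 0))"

definition partial :: "'a::euclidean_space \<Rightarrow> ('a \<Rightarrow> 'b::real_normed_vector) \<Rightarrow> 'a \<Rightarrow> 'b" where
  "partial b f x = vector_derivative (\<lambda>h::real. f (x + h *\<^sub>R b)) (at 0)"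

text \<open>All partial derivatives of order at most 2 exist and are continuous on \<open>U\<close>
  (intended for open \<open>U\<close>, where the values outside \<open>U\<close> do not matter).\<close>

definition C2_on :: "'a::euclidean_space set \<Rightarrow> ('a \<Rightarrow> 'b::real_normed_vector) \<Rightarrow> bool" where
  "C2_on U f \<longleftrightarrow>
     continuous_on U f \<and>
     (\<forall>b\<in>Basis. has_partial_on U b f \<and> continuous_on U (partial b f)) \<and>
     (\<forall>b\<in>Basis. \<forall>c\<in>Basis.
        has_partial_on U c (partial b f) \<and> continuous_on U (partial c (partial b f)))"

definition laplacian :: "('a::euclidean_space \<Rightarrow> 'b::real_normed_vector) \<Rightarrow> 'a \<Rightarrow> 'b" where
  "laplacian f x = (\<Sum>b\<in>Basis. partial b (partial b f) x)"

definition harmonic_on :: "'a::euclidean_space set \<Rightarrow> ('a \<Rightarrow> 'b::real_normed_vector) \<Rightarrow> bool" where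
  "harmonic_on U f \<longleftrightarrow> C2_on U f \<and> (\<forall>x\<in>U. laplacian f x = 0)"

text \<open>Points \<open>(x, t)\<close> of \<open>(n+1)\<close>-dimensional space and \<open>m\<close>-tuples of such points, where
  \<open>n = CARD('n)\<close> and \<open>m = CARD('m)\<close>. Tuples form the Euclidean space of dimension \<open>m(n+1)\<close>, with
  its standard orthonormal basis.\<close>

type_synonym 'n point = "(real, 'n) vec \<times> real"
type_synonym ('n, 'm) tuple = "('n point, 'm) vec"

definition upper_half :: "'n::finite point set" where
  "upper_half = {z. snd z > 0}"

definition upper_half_power :: "('n::finite, 'm::finite) tuple set" where
  "upper_half_power = {z. \<forall>j. z $ j \<in> upper_half}"

text \<open>Functions on a domain are total functions whose values off the domain are irrelevant to
  membership in the spaces below.\<close>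

definition h_space :: "(('n::finite, 'm::finite) tuple \<Rightarrow> complex) set" where
  "h_space = {f. harmonic_on upper_half_power f}"

definition h_tilde :: "(('n::finite, 'm::finite) tuple \<Rightarrow> complex) set" where
  "h_tilde = {f. \<forall>z\<in>upper_half_power. \<forall>j.
     harmonic_on upper_half (\<lambda>w. f (\<chi> i. if i = j then w else z $ i))}"

definition A_infty_norm ::
  "real ^ 'm \<Rightarrow> (('n::finite, 'm::finite) tuple \<Rightarrow> complex) \<Rightarrow> ennreal" where
  "A_infty_norm s f =
     (SUP z\<in>upper_half_power. ennreal (cmod (f z) * (\<Prod>j\<in>UNIV. snd (z $ j) powr (s $ j))))"

definition A_infty :: "real ^ 'm \<Rightarrow> (('n::finite, 'm::finite) tuple \<Rightarrow> complex) set" where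
  "A_infty s = {f \<in> h_space. A_infty_norm s f < \<infinity>}"

definition hA_infty :: "real ^ 'm \<Rightarrow> (('n::finite, 'm::finite) tuple \<Rightarrow> complex) set" where
  "hA_infty s = A_infty s \<inter> h_tilde"

text \<open>The case \<open>m = 1\<close>, with 1-tuples of points identified with points.\<close>

definition A1_infty_norm :: "real \<Rightarrow> ('n::finite point \<Rightarrow> complex) \<Rightarrow> ennreal" where
  "A1_infty_norm l g = (SUP z\<in>upper_half. ennreal (cmod (g z) * snd z powr l))"

definition A1_infty :: "real \<Rightarrow> ('n::finite point \<Rightarrow> complex) set" where
  "A1_infty l = {g. harmonic_on upper_half g \<and> A1_infty_norm l g < \<infinity>}"

definition Tr :: "(('n::finite, 'm::finite) tuple \<Rightarrow> complex) \<Rightarrow> 'n point \<Rightarrow> complex" where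
  "Tr f z = f (\<chi> j. z)"

definition Trace ::
  "(('n::finite, 'm::finite) tuple \<Rightarrow> complex) set \<Rightarrow> ('n point \<Rightarrow> complex) set" where
  "Trace X = {Tr f | f. f \<in> X}"

end

theory Submission
  imports Defs
begin

text \<open>
  The extension of a harmonic function \<open>g\<close> on the half-space to \<open>m\<close>-tuples is explicit: evaluate
  \<open>g\<close> at the barycentre,
  \<open>f (z\<^sub>1, \<dots>, z\<^sub>m) = g ((z\<^sub>1 + \<dots> + z\<^sub>m) / m)\<close>.
  The half-space is convex, so this makes sense, and on the diagonal it returns \<open>g\<close>. Each
  variable enters \<open>f\<close> only through a translation and a dilation by \<open>1 / m\<close>, so the Laplacian of
  \<open>f\<close> in any single variable is \<open>m\<^sup>-\<^sup>2\<close> times the Laplacian of \<open>g\<close> at the barycentre, hence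
  zero; summing over the variables, \<open>f\<close> is also harmonic jointly. Both facts are instances of
  \<open>harmonic_on_affine_pullback\<close>.

  The growth bound holds because \<open>t\<^sub>j \<le> t\<^sub>1 + \<dots> + t\<^sub>m = m \<tau>\<close>, where \<open>\<tau>\<close> is the height of the
  barycentre. Thus \<open>\<Prod>\<^sub>j t\<^sub>j powr s\<^sub>j \<le> (m \<tau>) powr l\<close>, and the weight of \<open>f\<close> is controlled by
  the weight of \<open>g\<close> up to the factor \<open>m powr l\<close>.

  In the converse direction the weights agree on the diagonal, so restricting the supremum
  to the diagonal gives the bound.
\<close>

text \<open>
  The chain rule for one partial derivative. The equation for \<open>f\<close> is required only on an open
  set, because functions on a domain carry arbitrary values elsewhere; the factor \<open>r\<close> lets the
  rule be applied again to the derivative it produces.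
\<close>

lemma partial_affine_pullback:
  fixes T :: "'a::euclidean_space \<Rightarrow> 'b::euclidean_space"
    and f :: "'a \<Rightarrow> 'c::real_normed_vector"
  assumes U: "open U" and T: "linear T"
    and L: "\<And>x. L x = a + c *\<^sub>R T x"
    and f: "\<And>x. x \<in> U \<Longrightarrow> f x = r *\<^sub>R g (L x)"
    and x: "x \<in> U" and g: "has_partial_on V (T b) g" "L x \<in> V"
  shows "((\<lambda>h. f (x + h *\<^sub>R b)) has_vector_derivative (r * c) *\<^sub>R partial (T b) g (L x)) (at 0)"
proof -
  have "((\<lambda>h. g (L x + h *\<^sub>R T b)) has_vector_derivative partial (T b) g (L x)) (at 0)"
    using g unfolding has_partial_on_def partial_def by (simp add: vector_derivative_works)
  moreover have "((\<lambda>h. c * h) has_vector_derivative c) (at 0)"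
    by (auto intro!: derivative_eq_intros)
  ultimately have "((\<lambda>h. g (L x + h *\<^sub>R T b)) \<circ> (\<lambda>h. c * h) has_vector_derivative
      c *\<^sub>R partial (T b) g (L x)) (at 0)"
    by (intro vector_diff_chain_at) auto
  moreover have "(\<lambda>h. g (L x + h *\<^sub>R T b)) \<circ> (\<lambda>h. c * h) = (\<lambda>h. g (L (x + h *\<^sub>R b)))"
    by (auto simp: fun_eq_iff L linear_add[OF T] linear_scale[OF T] scaleR_add_right add.assoc)
  ultimately have "((\<lambda>h. r *\<^sub>R g (L (x + h *\<^sub>R b))) has_vector_derivative
      r *\<^sub>R (c *\<^sub>R partial (T b) g (L x))) (at 0)"
    by (auto intro!: derivative_eq_intros)
  then have "((\<lambda>h. f (x + h *\<^sub>R b)) has_vector_derivative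
      r *\<^sub>R (c *\<^sub>R partial (T b) g (L x))) (at 0)"
  proof (rule has_vector_derivative_transform_within_open)
    show "open ((\<lambda>h. x + h *\<^sub>R b) -` U)"
      by (intro open_vimage U continuous_intros)
  qed (auto simp: x f)
  then show ?thesis by simp
qed

text \<open>
  The hypotheses on \<open>T\<close> say that it sends the standard basis to the standard basis and covers
  every basis vector equally often. The sum of the second partial derivatives upstairs then
  counts every second partial derivative of \<open>g\<close> the same number of times \<open>k\<close>, and is
  \<open>c\<^sup>2 k\<close> times the Laplacian of \<open>g\<close>.
\<close>

lemma harmonic_on_affine_pullback:
  fixes T :: "'a::euclidean_space \<Rightarrow> 'b::euclidean_space"
    and f :: "'a \<Rightarrow> 'c::real_normed_vector"
  assumes U: "open U" and T: "linear T" and L: "\<And>x. L x = a + c *\<^sub>R T x"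
    and LV: "\<And>x. x \<in> U \<Longrightarrow> L x \<in> V" and f: "\<And>x. x \<in> U \<Longrightarrow> f x = g (L x)"
    and TB: "\<And>b. b \<in> Basis \<Longrightarrow> T b \<in> Basis"
    and fibres: "\<And>d. d \<in> Basis \<Longrightarrow> card {b \<in> Basis. T b = d} = k"
    and g: "harmonic_on V g"
  shows "harmonic_on U f"
proof -
  have cL: "continuous_on U L"
    unfolding L using linear_continuous_on[of T U] T
    by (intro continuous_intros) (simp add: linear_conv_bounded_linear)
  have comp: "continuous_on U (\<lambda>x. u (L x))" if "continuous_on V u" for u :: "'b \<Rightarrow> 'c"
    by (rule continuous_on_compose2[OF that cL]) (auto simp: LV)
  have C2: "continuous_on V g"
    "\<And>b. b \<in> Basis \<Longrightarrow> has_partial_on V b g"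
    "\<And>b. b \<in> Basis \<Longrightarrow> continuous_on V (partial b g)"
    "\<And>b d. b \<in> Basis \<Longrightarrow> d \<in> Basis \<Longrightarrow> has_partial_on V d (partial b g)"
    "\<And>b d. b \<in> Basis \<Longrightarrow> d \<in> Basis \<Longrightarrow> continuous_on V (partial d (partial b g))"
    and lap: "\<And>y. y \<in> V \<Longrightarrow> laplacian g y = 0"
    using g by (auto simp: harmonic_on_def C2_on_def)
  have d1: "((\<lambda>h. f (x + h *\<^sub>R b)) has_vector_derivative c *\<^sub>R partial (T b) g (L x)) (at 0)"
    if "b \<in> Basis" "x \<in> U" for b x
    using partial_affine_pullback[OF U T L, of f 1 g x V b] that f LV C2(2) TB by simp
  have p1: "partial b f x = c *\<^sub>R partial (T b) g (L x)" if "b \<in> Basis" "x \<in> U" for b x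
    using vector_derivative_at[OF d1[OF that]] by (simp add: partial_def)
  have d2: "((\<lambda>h. partial b f (x + h *\<^sub>R d)) has_vector_derivative
      c\<^sup>2 *\<^sub>R partial (T d) (partial (T b) g) (L x)) (at 0)"
    if "b \<in> Basis" "d \<in> Basis" "x \<in> U" for b d x
    using partial_affine_pullback[OF U T L, of "partial b f" c "partial (T b) g" x V d]
      that p1 LV C2(4) TB by (simp add: power2_eq_square)
  have p2: "partial d (partial b f) x = c\<^sup>2 *\<^sub>R partial (T d) (partial (T b) g) (L x)"
    if "b \<in> Basis" "d \<in> Basis" "x \<in> U" for b d x
    using vector_derivative_at[OF d2[OF that]] by (simp add: partial_def[of d])
  have "laplacian f x = 0" if x: "x \<in> U" for x
  proof -
    let ?D = "\<lambda>d. partial d (partial d g) (L x)"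
    have "laplacian f x = (\<Sum>b\<in>Basis. c\<^sup>2 *\<^sub>R ?D (T b))"
      unfolding laplacian_def using x by (intro sum.cong) (auto simp: p2)
    also have "\<dots> = c\<^sup>2 *\<^sub>R (\<Sum>b\<in>Basis. ?D (T b))"
      by (simp add: scaleR_right.sum)
    also have "(\<Sum>b\<in>Basis. ?D (T b)) = (\<Sum>d\<in>Basis. \<Sum>b\<in>{b \<in> Basis. T b = d}. ?D (T b))"
      using TB by (intro sum.group[symmetric]) auto
    also have "\<dots> = (\<Sum>d\<in>Basis. real k *\<^sub>R ?D d)"
      by (intro sum.cong) (auto simp: fibres sum_constant_scaleR)
    also have "\<dots> = real k *\<^sub>R laplacian g (L x)"
      by (simp add: laplacian_def scaleR_right.sum)
    finally show ?thesis using lap LV x by simp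
  qed
  moreover have "C2_on U f"
    unfolding C2_on_def
  proof (intro conjI ballI)
    show "continuous_on U f"
      using comp[OF C2(1)] by (simp add: f cong: continuous_on_cong)
  next
    fix b :: 'a assume b: "b \<in> Basis"
    show "has_partial_on U b f"
      using d1[OF b] by (auto simp: has_partial_on_def intro: differentiableI_vector)
    show "continuous_on U (partial b f)"
      using comp[OF C2(3)[OF TB[OF b]]]
      by (simp add: p1[OF b] continuous_on_scaleR cong: continuous_on_cong)
  next
    fix b d :: 'a assume bd: "b \<in> Basis" "d \<in> Basis"
    show "has_partial_on U d (partial b f)"
      using d2[OF bd] by (auto simp: has_partial_on_def intro: differentiableI_vector)
    show "continuous_on U (partial d (partial b f))"
      using comp[OF C2(5)[OF TB[OF bd(1)] TB[OF bd(2)]]]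
      by (simp add: p2[OF bd] continuous_on_scaleR cong: continuous_on_cong)
  qed
  ultimately show ?thesis by (simp add: harmonic_on_def)
qed

lemma SUP_ennreal_less_top_iff:
  "(SUP z\<in>S. ennreal (u z)) < top \<longleftrightarrow> (\<exists>C. \<forall>z\<in>S. u z \<le> C)"
proof
  assume fin: "(SUP z\<in>S. ennreal (u z)) < top"
  have "u z \<le> enn2real (SUP z\<in>S. ennreal (u z))" if "z \<in> S" for z
  proof -
    have "ennreal (u z) \<le> (SUP z\<in>S. ennreal (u z))"
      using that by (rule SUP_upper)
    also have "\<dots> = ennreal (enn2real (SUP z\<in>S. ennreal (u z)))"
      using fin by (simp add: less_top)
    finally show ?thesis by (simp add: ennreal_le_iff)
  qed
  then show "\<exists>C. \<forall>z\<in>S. u z \<le> C" by blast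
next
  assume "\<exists>C. \<forall>z\<in>S. u z \<le> C"
  then obtain C where "\<forall>z\<in>S. u z \<le> C" by blast
  then have "(SUP z\<in>S. ennreal (u z)) \<le> ennreal C"
    by (intro SUP_least ennreal_leI) auto
  then show "(SUP z\<in>S. ennreal (u z)) < top"
    using ennreal_less_top le_less_trans by metis
qed

lemma open_upper_half: "open upper_half"
  unfolding upper_half_def by (intro open_Collect_less continuous_intros)

lemma open_upper_half_power: "open (upper_half_power :: ('n::finite, 'm::finite) tuple set)"
proof -
  have "open (\<Inter>j. (\<lambda>z :: ('n, 'm) tuple. z $ j) -` upper_half)"
    by (intro open_INT finite ballI open_vimage open_upper_half continuous_intros)
  also have "(\<Inter>j. (\<lambda>z :: ('n, 'm) tuple. z $ j) -` upper_half) = upper_half_power"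
    by (auto simp: upper_half_power_def)
  finally show ?thesis .
qed

lemma sum_nth_axis: "(\<Sum>i\<in>UNIV. axis j b $ i) = b"
  by (simp add: axis_def)

text \<open>
  The fibre consists of the copies of \<open>d\<close> placed in each of the coordinates. This supplies
  the fibre hypothesis of \<open>harmonic_on_affine_pullback\<close> for the barycentre map.
\<close>

lemma card_Basis_sum_nth:
  fixes d :: "'a::euclidean_space"
  assumes "d \<in> Basis"
  shows "card {b \<in> Basis :: ('a ^ 'm) set. (\<Sum>i\<in>UNIV. b $ i) = d} = CARD('m::finite)"
proof -
  have "{b \<in> Basis :: ('a ^ 'm) set. (\<Sum>i\<in>UNIV. b $ i) = d} = range (\<lambda>j. axis j d)"
    using assms by (auto simp: Basis_vec_def sum_nth_axis)
  moreover have "inj (\<lambda>j :: 'm. axis j d)"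
    using assms nonzero_Basis[OF assms] by (auto simp: inj_on_def axis_eq_axis)
  ultimately show ?thesis by (simp add: card_image)
qed

theorem theorem5:
  fixes s :: "real ^ 'm" and l :: real
  assumes "\<forall>j. s $ j > 0"
    and "l = (\<Sum>j\<in>UNIV. s $ j)"
  shows "(A1_infty l :: ('n::finite point \<Rightarrow> complex) set)
           \<subseteq> Trace (hA_infty s :: (('n, 'm) tuple \<Rightarrow> complex) set)
         \<and> (\<forall>f :: ('n, 'm) tuple \<Rightarrow> complex.
              f \<in> A_infty s \<and> harmonic_on upper_half (Tr f) \<longrightarrow> Tr f \<in> A1_infty l)"
proof (intro conjI subsetI allI impI)
  fix g :: "'n point \<Rightarrow> complex"
  assume "g \<in> A1_infty l"
  then obtain C where g: "harmonic_on upper_half g"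
    and C: "\<And>z. z \<in> upper_half \<Longrightarrow> cmod (g z) * snd z powr l \<le> C"
    by (auto simp: A1_infty_def A1_infty_norm_def SUP_ennreal_less_top_iff)
  define c where "c = 1 / real CARD('m)"
  have c: "0 < c" by (simp add: c_def)
  define S :: "('n, 'm) tuple \<Rightarrow> 'n point" where "S = (\<lambda>z. \<Sum>i\<in>UNIV. z $ i)"
  have S: "linear S"
    unfolding S_def by (intro linearI) (auto simp: sum.distrib scaleR_right.sum)
  define f where "f = (\<lambda>z. g (c *\<^sub>R S z))"
  have snd_S: "snd (S z) = (\<Sum>i\<in>UNIV. snd (z $ i))" for z
    by (simp add: S_def snd_sum)
  have bary: "c *\<^sub>R S z \<in> upper_half" if "z \<in> upper_half_power" for z
    using that c by (auto simp: upper_half_power_def upper_half_def snd_S intro!: mult_pos_pos sum_pos)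
  have TB: "S b \<in> Basis" if "b \<in> Basis" for b
    using that unfolding S_def by (auto simp: Basis_vec_def sum_nth_axis)
  have "f \<in> h_space"
    unfolding h_space_def mem_Collect_eq
  proof (rule harmonic_on_affine_pullback[OF open_upper_half_power S _ _ _ TB _ g])
    show "c *\<^sub>R S z = 0 + c *\<^sub>R S z" for z by simp
    show "card {b \<in> Basis. S b = d} = CARD('m)" if "d \<in> Basis" for d
      using card_Basis_sum_nth[OF that] by (simp add: S_def)
  qed (use bary in \<open>auto simp: f_def\<close>)
  moreover have "A_infty_norm s f < \<infinity>"
    unfolding A_infty_norm_def infinity_ennreal_def SUP_ennreal_less_top_iff
  proof (intro exI ballI)
    fix z :: "('n, 'm) tuple" assume z: "z \<in> upper_half_power"
    let ?t = "\<lambda>j. snd (z $ j)"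
    have t: "0 < ?t j" for j
      using z by (auto simp: upper_half_power_def upper_half_def)
    then have t_le: "?t j \<le> snd (S z)" for j
      unfolding snd_S by (intro member_le_sum) (auto intro: less_imp_le)
    have pos: "0 < snd (S z)" using t t_le less_le_trans by blast
    have "(\<Prod>j\<in>UNIV. ?t j powr s $ j) \<le> (\<Prod>j\<in>UNIV. snd (S z) powr s $ j)"
      using t t_le assms(1) by (intro prod_mono) (auto intro!: powr_mono2 intro: less_imp_le)
    also have "\<dots> = snd (S z) powr l"
      using pos by (simp add: assms(2) powr_sum)
    also have "\<dots> = (1 / c) powr l * snd (c *\<^sub>R S z) powr l"
      using pos c by (simp flip: powr_mult)
    finally have "cmod (f z) * (\<Prod>j\<in>UNIV. ?t j powr s $ j)
        \<le> cmod (f z) * ((1 / c) powr l * snd (c *\<^sub>R S z) powr l)"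
      by (intro mult_left_mono) auto
    also have "\<dots> = (1 / c) powr l * (cmod (g (c *\<^sub>R S z)) * snd (c *\<^sub>R S z) powr l)"
      by (simp add: f_def)
    also have "\<dots> \<le> (1 / c) powr l * C"
      using C[OF bary[OF z]] by (intro mult_left_mono) auto
    finally show "cmod (f z) * (\<Prod>j\<in>UNIV. ?t j powr s $ j) \<le> (1 / c) powr l * C" .
  qed
  moreover have "f \<in> h_tilde"
    unfolding h_tilde_def mem_Collect_eq
  proof (intro ballI allI)
    fix z :: "('n, 'm) tuple" and j assume z: "z \<in> upper_half_power"
    let ?Z = "\<lambda>w. \<chi> i. if i = j then w else z $ i"
    have split: "S (?Z w) = (\<Sum>i\<in>UNIV - {j}. z $ i) + w" for w
      unfolding S_def by (subst sum.remove[of _ j]) (auto intro!: sum.cong)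
    show "harmonic_on upper_half (\<lambda>w. f (?Z w))"
    proof (rule harmonic_on_affine_pullback[OF open_upper_half linear_id _ _ _ _ _ g])
      show "c *\<^sub>R S (?Z w) = c *\<^sub>R (\<Sum>i\<in>UNIV - {j}. z $ i) + c *\<^sub>R id w" for w
        by (simp only: split scaleR_add_right id_apply)
      show "c *\<^sub>R S (?Z w) \<in> upper_half" if "w \<in> upper_half" for w
        using that z by (intro bary) (auto simp: upper_half_power_def)
      show "card {b \<in> Basis. id b = d} = 1" if "d \<in> Basis" for d :: "'n point"
      proof -
        have "{b \<in> Basis. id b = d} = {d}" using that by auto
        then show ?thesis by simp
      qed
    qed (auto simp: f_def)
  qed
  ultimately have "f \<in> hA_infty s"
    by (simp add: hA_infty_def A_infty_def)
  \<comment> \<open>The formula defines \<open>f\<close> off the domain too, so this is an equality of total functions,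
      as membership in \<open>Trace\<close> demands.\<close>
  moreover have "Tr f = g"
    by (simp add: fun_eq_iff Tr_def f_def S_def c_def scaleR_left.sum sum_constant_scaleR)
  ultimately show "g \<in> Trace (hA_infty s :: (('n, 'm) tuple \<Rightarrow> complex) set)"
    unfolding Trace_def by blast
next
  fix f :: "('n, 'm) tuple \<Rightarrow> complex"
  assume "f \<in> A_infty s \<and> harmonic_on upper_half (Tr f)"
  then obtain C where h: "harmonic_on upper_half (Tr f)"
    and C: "\<And>z. z \<in> upper_half_power \<Longrightarrow>
      cmod (f z) * (\<Prod>j\<in>UNIV. snd (z $ j) powr s $ j) \<le> C"
    by (auto simp: A_infty_def A_infty_norm_def SUP_ennreal_less_top_iff)
  have "cmod (Tr f z) * snd z powr l \<le> C" if z: "z \<in> upper_half" for z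
    using C[of "\<chi> j. z"] z
    by (simp add: upper_half_power_def Tr_def assms(2) powr_sum upper_half_def)
  then show "Tr f \<in> A1_infty l"
    using h unfolding A1_infty_def A1_infty_norm_def infinity_ennreal_def SUP_ennreal_less_top_iff
    by blast
qed

end
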